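(* Let $a\ge2$, $k\ge1$ be integers, let $0<q<1$ be real, and put $Q=q^a$. The denominator $\sum_{m\ge0}z^mq^{a(m+1)}\Phi(q^{a(m+1)})^k$ of $J(z,q)$ has no zero on the disk $$|z|\le\beta_k(Q)^{-1}.$$ Consequently every section $W_{a,d}(\cdot,k)$ has no pole for $0<q\le Q_*(k)^{1/a}$, and $W_{a,d}(q,k)\to T(q)$ exponentially as $d\to\infty$ at each such fixed $q$. If $Q<Q_*(k)$, the error is $O_q(\beta_k(Q)^d)$.
   Context: $\Phi(q)=\prod_{n\ge1}(1-q^n)$. For integers $a,d\ge2$, $k\ge1$ and $0<|q|<1$, $$J(z,q)=\frac{\sum_{m\ge0}z^mq^{am+1}\Phi(q^{am+1})^k}{\sum_{m\ge0}z^mq^{a(m+1)}\Phi(q^{a(m+1)})^k},\quad W_{a,d}(q,k)=\frac1d\sum_{z^d=1}J(z,q),\quad T(q)=q^{1-a}\frac{\Phi(q)^k}{\Phi(q^a)^k}.$$ Both series converge for $|z|<|q|^{-a}$, and $W_{a,d}(\cdot,k)$ is meromorphic on $0<|q|<1$. For $0<Q<1$, $\beta_k(Q)=Q\prod_{n\ge1}(1+Q^n)^k$, which is strictly increasing from $0$ to $\infty$ on $(0,1)$; $Q_*(k)\in(0,1)$ is the unique number with $\beta_k(Q_*(k))=1$. "Exponentially" means that the error is $O(\rho^d)$ for some $\rho<1$ depending on the fixed parameters. *)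

theory Defs
  imports "HOL-Complex_Analysis.Complex_Analysis" "HOL-Library.Landau_Symbols"
begin

definition Phi :: "complex \<Rightarrow> complex" where
  "Phi q = (\<Prod>n. 1 - q ^ Suc n)"

text \<open>
  The two series converge for \<open>norm z < 1 / norm q ^ a\<close> when \<open>0 < norm q < 1\<close>; outside this disk
  the values below carry no meaning.
\<close>

definition J_num :: "nat \<Rightarrow> nat \<Rightarrow> complex \<Rightarrow> complex \<Rightarrow> complex" where
  "J_num a k z q = (\<Sum>m. z ^ m * q ^ (a * m + 1) * Phi (q ^ (a * m + 1)) ^ k)"

definition J_den :: "nat \<Rightarrow> nat \<Rightarrow> complex \<Rightarrow> complex \<Rightarrow> complex" where
  "J_den a k z q = (\<Sum>m. z ^ m * q ^ (a * (m + 1)) * Phi (q ^ (a * (m + 1))) ^ k)"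

definition J_quot :: "nat \<Rightarrow> nat \<Rightarrow> complex \<Rightarrow> complex \<Rightarrow> complex" where
  "J_quot a k z q = J_num a k z q / J_den a k z q"

definition W_section :: "nat \<Rightarrow> nat \<Rightarrow> complex \<Rightarrow> nat \<Rightarrow> complex" where
  "W_section a d q k = 1 / of_nat d * (\<Sum>z | z ^ d = 1. J_quot a k z q)"

definition T_lim :: "nat \<Rightarrow> nat \<Rightarrow> complex \<Rightarrow> complex" where
  "T_lim a k q = q powi (1 - int a) * (Phi q ^ k / Phi (q ^ a) ^ k)"

definition beta :: "nat \<Rightarrow> real \<Rightarrow> real" where
  "beta k Q = Q * (\<Prod>n. (1 + Q ^ Suc n) ^ k)"

text \<open>
  For \<open>k \<ge> 1\<close> the function \<open>beta k\<close> increases strictly from \<open>0\<close> to \<open>\<infinity>\<close> on \<open>(0,1)\<close>, so the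
  description below picks out exactly one number.
\<close>

definition Q_star :: "nat \<Rightarrow> real" where
  "Q_star k = (THE Q. 0 < Q \<and> Q < 1 \<and> beta k Q = 1)"

end

theory Submission
  imports Defs
begin

text \<open>
  Put \<open>Q = q\<^sup>a\<close>. The denominator of \<open>J\<close> is a power series in \<open>z\<close> with positive coefficients
  \<open>c\<^sub>m = Q\<^sup>m\<^sup>+\<^sup>1 \<Phi>(Q\<^sup>m\<^sup>+\<^sup>1)\<^sup>k\<close>, and \<open>c\<^sub>m\<^sub>+\<^sub>1 / c\<^sub>m \<le> c\<^sub>1 / c\<^sub>0 = \<beta>\<^sub>k(Q)\<close>, strictly for \<open>m \<ge> 1\<close>. After
  rescaling by \<open>\<beta>\<^sub>k(Q)\<close> the coefficients decrease, so the Enestrom--Kakeya argument (multiply by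
  \<open>1 - w\<close>) excludes zeros on the closed disk. For \<open>Q \<le> Q\<^sub>*(k)\<close> that disk contains the unit disk, so
  \<open>J\<close> is holomorphic near it; averaging over the \<open>d\<close>-th roots of unity keeps only the Taylor
  coefficients of index divisible by \<open>d\<close>, of which the zeroth is \<open>T(q)\<close> and the others are small
  by Cauchy's inequality.
\<close>

section \<open>The Euler product on the unit disk\<close>

text \<open>Kept generic in the field so that it serves both the complex \<open>Phi\<close> and its
  real counterpart \<open>phi\<close> below.\<close>

lemma Phi_factors_convergent:
  fixes q :: "'a :: {real_normed_field, banach}"
  assumes "norm q < 1"
  shows "convergent_prod (\<lambda>n. 1 - q ^ Suc n)"
proof -
  have "summable (\<lambda>n. norm (1 - q ^ Suc n - 1))"
    using summable_mult[OF summable_geometric[of "norm q"], of "norm q"] assms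
    by (simp add: norm_power norm_mult)
  thus ?thesis
    by (intro abs_convergent_prod_imp_convergent_prod) (simp add: abs_convergent_prod_conv_summable)
qed

lemma Phi_holomorphic: "Phi holomorphic_on ball 0 1"
proof (rule holomorphic_uniform_sequence[of _ "\<lambda>N q. \<Prod>n<N. 1 - q ^ Suc n"])
  fix x :: complex
  assume x: "x \<in> ball 0 1"
  then obtain d where d: "d > 0" "cball x d \<subseteq> ball 0 1"
    by (meson open_ball open_contains_cball)
  \<comment> \<open>By compactness the norm attains its maximum on the closed disk, so r < 1 and
    r^(n+1) is a summable majorant there.\<close>
  obtain r where r: "r < 1" "\<And>q. q \<in> cball x d \<Longrightarrow> norm q \<le> r"
  proof -
    have "\<exists>u\<in>cball x d. \<forall>q\<in>cball x d. norm q \<le> norm u"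
      using d(1) by (intro continuous_attains_sup continuous_intros) auto
    thus ?thesis using that d(2) by (auto simp: subset_eq)
  qed
  have "uniformly_convergent_on (cball x d) (\<lambda>N q. \<Prod>n<N. 1 - q ^ Suc n)"
  proof (rule uniformly_convergent_on_prod')
    have "norm (norm (1 - q ^ Suc n - 1)) \<le> r ^ Suc n" if "q \<in> cball x d" for q n
      using power_mono[OF r(2)[OF that], of "Suc n"] by (simp add: norm_power norm_mult)
    moreover have "summable (\<lambda>n. r ^ Suc n)"
      using r(1) order_trans[OF norm_ge_zero r(2)[of x]] d(1)
      by (subst summable_Suc_iff) (intro summable_geometric, simp)
    ultimately show "uniformly_convergent_on (cball x d) (\<lambda>N q. \<Sum>n<N. norm (1 - q ^ Suc n - 1))"
      by (rule Weierstrass_m_test')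
  qed (auto intro!: continuous_intros)
  then obtain l where l: "uniform_limit (cball x d) (\<lambda>N q. \<Prod>n<N. 1 - q ^ Suc n) l sequentially"
    by (auto simp: uniformly_convergent_on_def)
  have "l q = Phi q" if q: "q \<in> cball x d" for q
  proof -
    have "(\<lambda>N. \<Prod>n<N. 1 - q ^ Suc n) \<longlonglongrightarrow> Phi q"
      using convergent_prod_LIMSEQ[OF Phi_factors_convergent, of q] q d(2)
      by (auto simp: Phi_def LIMSEQ_lessThan_iff_atMost)
    thus ?thesis
      using tendsto_uniform_limitI[OF l q] by (simp add: LIMSEQ_unique)
  qed
  hence "uniform_limit (cball x d) (\<lambda>N q. \<Prod>n<N. 1 - q ^ Suc n) Phi sequentially"
    by (intro uniform_limit_cong'[THEN iffD1, OF _ _ l]) auto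
  thus "\<exists>d>0. cball x d \<subseteq> ball 0 1 \<and>
      uniform_limit (cball x d) (\<lambda>N q. \<Prod>n<N. 1 - q ^ Suc n) Phi sequentially"
    using d by blast
qed (auto intro!: holomorphic_intros)

text \<open>A real-valued copy of \<open>Phi\<close>, so that factors and products can be compared
  by order; \<open>Phi_of_real\<close> carries the results back.\<close>

definition phi :: "real \<Rightarrow> real" where
  "phi x = (\<Prod>n. 1 - x ^ Suc n)"

lemma has_prod_phi:
  assumes "\<bar>x\<bar> < 1"
  shows "(\<lambda>n. 1 - x ^ Suc n) has_prod phi x"
  unfolding phi_def using Phi_factors_convergent[of x] assms by (auto simp del: power_Suc)

lemma Phi_of_real:
  assumes "\<bar>x\<bar> < 1"
  shows "Phi (of_real x) = of_real (phi x)"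
proof -
  have "(\<lambda>n. of_real (1 - x ^ Suc n) :: complex) has_prod of_real (phi x)"
    using has_prod_phi[OF assms] by (subst has_prod_of_real_iff)
  hence "(\<lambda>n. 1 - of_real x ^ Suc n :: complex) has_prod of_real (phi x)"
    by simp
  thus ?thesis
    unfolding Phi_def by (metis has_prod_unique)
qed

lemma phi_pos:
  assumes "\<bar>x\<bar> < 1"
  shows "phi x > 0"
proof -
  have "x ^ Suc n < 1" for n
    using assms power_Suc_less_one[of "\<bar>x\<bar>" n] power_abs[of x "Suc n"]
    by (cases "x = 0") auto
  thus ?thesis
    unfolding phi_def using Phi_factors_convergent[of x] assms
    by (intro less_0_prodinf) auto
qed

lemma continuous_on_phi: "continuous_on {-1<..<1} phi"
proof -
  have "continuous_on {-1<..<1} (\<lambda>x. Re (Phi (of_real x)))"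
    by (intro continuous_intros continuous_on_compose2[OF
          holomorphic_on_imp_continuous_on[OF Phi_holomorphic]]) auto
  thus ?thesis
    by (rule continuous_on_eq) (auto simp: Phi_of_real)
qed

section \<open>Ratios of Euler products at successive powers\<close>

text \<open>With y = x^(n+1) this is the gap between the n-th factors of the two products compared
  next. For 0 < y < 1 it is nonnegative, and it is positive exactly when m > 0.\<close>

lemma phi_ratio_factor_diff:
  fixes y :: real
  shows "(1 - y\<^sup>2) * (1 - y ^ Suc m) - (1 - y ^ Suc (Suc m)) * (1 - y) = y * (1 - y) * (1 - y ^ m)"
  by (simp add: algebra_simps power2_eq_square)

text \<open>Both sides are compared factor by factor. After division, the ratio of
  \<open>phi\<close> at x^(m+2) and x^(m+1) is largest at m = 0; for m > 0 the factors at n = 0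
  already differ strictly.\<close>

lemma
  assumes "0 < x" "x < 1"
  shows phi_ratio_le: "phi (x ^ Suc (Suc m)) * phi x \<le> phi (x\<^sup>2) * phi (x ^ Suc m)"
    and phi_ratio_less: "m > 0 \<Longrightarrow> phi (x ^ Suc (Suc m)) * phi x < phi (x\<^sup>2) * phi (x ^ Suc m)"
proof -
  define f where "f = (\<lambda>n. (1 - (x ^ Suc (Suc m)) ^ Suc n) * (1 - x ^ Suc n))"
  define g where "g = (\<lambda>n. (1 - (x\<^sup>2) ^ Suc n) * (1 - (x ^ Suc m) ^ Suc n))"
  have lt1: "x ^ j < 1" if "j > 0" for j
    using assms that by (simp add: power_less_one_iff)
  have phi: "(\<lambda>n. 1 - (x ^ j) ^ Suc n) has_prod phi (x ^ j)" if "j > 0" for j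
    using lt1[OF that] assms by (intro has_prod_phi) (simp add: abs_of_pos)
  have f: "f has_prod (phi (x ^ Suc (Suc m)) * phi x)"
    unfolding f_def using phi[of "Suc (Suc m)"] phi[of 1] by (intro has_prod_mult) auto
  have g: "g has_prod (phi (x\<^sup>2) * phi (x ^ Suc m))"
    unfolding g_def using phi[of 2] phi[of "Suc m"] by (intro has_prod_mult) auto
  have diff: "g n - f n = x ^ Suc n * (1 - x ^ Suc n) * (1 - (x ^ Suc n) ^ m)" for n
    using phi_ratio_factor_diff[of "x ^ Suc n" m]
    unfolding f_def g_def by (simp only: power_mult[symmetric] mult.commute)
  have pos: "f n > 0" for n
    unfolding f_def using lt1[of "Suc n"] lt1[of "Suc (Suc m) * Suc n"]
    by (simp only: power_mult[symmetric]) simp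
  have le: "f n \<le> g n" for n
  proof -
    have "0 \<le> g n - f n"
      unfolding diff using assms lt1[of "Suc n"] by (intro mult_nonneg_nonneg) (auto intro: power_le_one)
    thus ?thesis by simp
  qed
  show "phi (x ^ Suc (Suc m)) * phi x \<le> phi (x\<^sup>2) * phi (x ^ Suc m)"
    using has_prod_le[OF f g] pos le by (meson less_imp_le)
  show "phi (x ^ Suc (Suc m)) * phi x < phi (x\<^sup>2) * phi (x ^ Suc m)" if "m > 0"
  proof (rule has_prod_less[OF _ f g pos le])
    have "0 < g 0 - f 0"
      unfolding diff using assms lt1[OF that] by simp
    thus "f 0 < g 0" by simp
  qed
qed

section \<open>The function \<open>beta\<close> and the threshold \<open>Q_star\<close>\<close>

text \<open>Each factor is 1 + y = (1 - y^2) / (1 - y) with y = x^(n+1). This turns the product in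
  \<open>beta\<close> into the quotient that bounds the coefficient ratios of the
  denominator.\<close>

lemma has_prod_one_plus_powers:
  fixes x :: real
  assumes "0 < x" "x < 1"
  shows "(\<lambda>n. (1 + x ^ Suc n) ^ k) has_prod (phi (x\<^sup>2) / phi x) ^ k"
proof -
  have *: "x\<^sup>2 < 1"
    using assms by (simp add: power_less_one_iff)
  have eq: "1 + x ^ Suc n = (1 - (x\<^sup>2) ^ Suc n) / (1 - x ^ Suc n)" for n
  proof -
    have "x ^ Suc n < 1"
      using assms power_Suc_less_one by blast
    moreover have "(x\<^sup>2) ^ Suc n = (x ^ Suc n)\<^sup>2"
      by (simp only: power_mult[symmetric] mult.commute)
    ultimately show ?thesis
      by (simp add: divide_simps) (simp add: algebra_simps power2_eq_square)
  qed
  show ?thesis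
    unfolding eq using assms *
    by (intro has_prod_power has_prod_divide has_prod_phi) (auto simp: abs_of_pos)
qed

lemma beta_eq:
  assumes "0 < x" "x < 1"
  shows "beta k x = x * (phi (x\<^sup>2) / phi x) ^ k"
  unfolding beta_def using has_prod_one_plus_powers[OF assms, of k] by (simp only: has_prod_unique[symmetric])

text \<open>Numerator and denominator are hard to compare separately, but in the product form every
  factor 1 + x^(n+1) increases with x.\<close>

lemma phi_quotient_mono:
  assumes "0 < x" "x \<le> y" "y < 1"
  shows "phi (x\<^sup>2) / phi x \<le> phi (y\<^sup>2) / phi y"
proof (rule has_prod_le)
  show "(\<lambda>n. 1 + x ^ Suc n) has_prod (phi (x\<^sup>2) / phi x)"
    using has_prod_one_plus_powers[of x 1] assms by simp
  show "(\<lambda>n. 1 + y ^ Suc n) has_prod (phi (y\<^sup>2) / phi y)"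
    using has_prod_one_plus_powers[of y 1] assms by simp
qed (use assms in \<open>auto intro!: mult_mono power_mono\<close>)

lemma phi_quotient_gt_one:
  assumes "0 < x" "x < 1"
  shows "1 < phi (x\<^sup>2) / phi x"
proof (rule has_prod_less[OF _ has_prod_one])
  show "(\<lambda>n. 1 + x ^ Suc n) has_prod (phi (x\<^sup>2) / phi x)"
    using has_prod_one_plus_powers[of x 1] assms by simp
qed (use assms in auto)

lemma beta_less:
  assumes "0 < x" "x < y" "y < 1"
  shows "beta k x < beta k y"
proof -
  note phi_quotient_mono[of x y] phi_quotient_gt_one[of x] phi_quotient_gt_one[of y]
  thus ?thesis
    using assms by (auto simp: beta_eq intro!: mult_less_le_imp_less power_mono)
qed

lemma beta_pos:
  assumes "0 < x" "x < 1"
  shows "beta k x > 0"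
  using assms phi_quotient_gt_one[of x] by (simp add: beta_eq)

lemma beta_gt_self:
  assumes "0 < x" "x < 1" "k \<ge> 1"
  shows "x < beta k x"
  using assms phi_quotient_gt_one[of x] by (simp add: beta_eq one_less_power)

lemma continuous_on_beta: "continuous_on {0<..<1} (beta k)"
proof -
  have "phi x \<noteq> 0" if "x \<in> {0<..<1}" for x
    using phi_pos[of x] that by auto
  moreover have gt: "-1 < x\<^sup>2" for x :: real
    using zero_le_power2[of x] by linarith
  ultimately have "continuous_on {0<..<1} (\<lambda>x. x * (phi (x\<^sup>2) / phi x) ^ k)"
    by (intro continuous_intros continuous_on_compose2[OF continuous_on_phi])
       (auto simp: power_less_one_iff gt)
  thus ?thesis
    by (rule continuous_on_eq) (auto simp: beta_eq)
qed

lemma beta_half_gt_one: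
  assumes "k \<ge> 1"
  shows "beta k (1/2) > 1"
proof -
  let ?f = "\<lambda>n. 1 + (1/2 :: real) ^ Suc n"
  define P where "P = phi ((1/2)\<^sup>2) / phi (1/2)"
  have "prod ?f {..<3} \<le> prodinf ?f"
    using has_prod_one_plus_powers[of "1/2" 1] by (intro prod_le_prodinf) auto
  \<comment> \<open>The first three factors give 3/2 * 5/4 * 9/8 = 135/64, which exceeds 2 and so
    outweighs the prefactor 1/2 of \<open>beta\<close>.\<close>
  hence P: "135/64 \<le> P"
    using has_prod_one_plus_powers[of "1/2" 1]
    by (simp add: P_def has_prod_unique[symmetric] eval_nat_numeral)
  have "P ^ 1 \<le> P ^ k"
    using P assms by (intro power_increasing) auto
  thus ?thesis
    using P by (simp add: beta_eq flip: P_def)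
qed

text \<open>Existence comes from the intermediate value theorem on an interval ending at 1/2,
  uniqueness from strict monotonicity; only then can the definite description be unfolded.\<close>

lemma Q_star:
  assumes "k \<ge> 1"
  shows "0 < Q_star k" "Q_star k < 1" "beta k (Q_star k) = 1"
proof -
  have "\<exists>!Q. 0 < Q \<and> Q < 1 \<and> beta k Q = 1"
  proof (rule ex_ex1I)
    define M where "M = (phi ((1/2)\<^sup>2) / phi (1/2)) ^ k"
    \<comment> \<open>The left endpoint: since x <= 1/2, the quotient at x is at most that at 1/2,
      so \<open>beta k x\<close> is at most x * M = 1/2.\<close>
    define x where "x = 1 / (2 * M)"
    have M: "M \<ge> 1"
      unfolding M_def using phi_quotient_gt_one[of "1/2"] by (intro one_le_power) auto
    hence x: "0 < x" "x \<le> 1/2"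
      by (auto simp: x_def field_simps)
    have "beta k x \<le> x * M"
      using x phi_quotient_mono[of x "1/2"] phi_quotient_gt_one[of x]
      by (auto simp: beta_eq M_def intro!: mult_left_mono power_mono)
    hence "beta k x \<le> 1"
      using M by (simp add: x_def)
    moreover have "continuous_on {x..1/2} (beta k)"
      using x by (intro continuous_on_subset[OF continuous_on_beta]) auto
    ultimately obtain Q where "x \<le> Q" "Q \<le> 1/2" "beta k Q = 1"
      using IVT'[of "beta k" x 1 "1/2"] beta_half_gt_one[OF assms] x(2) by auto
    thus "\<exists>Q. 0 < Q \<and> Q < 1 \<and> beta k Q = 1"
      using x(1) by (intro exI[of _ Q]) auto
  next
    show "x = y" if "0 < x \<and> x < 1 \<and> beta k x = 1" "0 < y \<and> y < 1 \<and> beta k y = 1" for x y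
      using that beta_less[of x y k] beta_less[of y x k] by (cases x y rule: linorder_cases) auto
  qed
  from theI'[OF this] show "0 < Q_star k" "Q_star k < 1" "beta k (Q_star k) = 1"
    by (auto simp: Q_star_def)
qed

section \<open>Zero-free closed disk for decreasing coefficients\<close>

text \<open>A zero \<open>w\<close> would force \<open>w ^ Suc m = 1\<close> wherever \<open>b\<close> decreases strictly; two consecutive
  such exponents give \<open>w = 1\<close>, where the sum is positive.\<close>

lemma decreasing_coeffs_nonzero:
  fixes b :: "nat \<Rightarrow> real" and w :: complex
  assumes pos: "\<And>m. b m > 0" and dec: "\<And>m. b (Suc m) \<le> b m" and sum: "summable b"
    and less: "b (Suc (Suc j)) < b (Suc j)" "b (Suc j) < b j"
    and w: "norm w \<le> 1"
  shows "(\<Sum>m. of_real (b m) * w ^ m) \<noteq> 0"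
proof
  assume zero: "(\<Sum>m. of_real (b m) * w ^ m) = 0"
  let ?e = "\<lambda>m. b m - b (Suc m)"
  have le1: "norm (w ^ m) \<le> 1" for m
    using w by (simp add: norm_power power_le_one)
  have "summable (\<lambda>m. of_real (b m) * w ^ m)"
    using le1 pos by (intro summable_comparison_test'[OF sum, of 0])
      (auto simp: norm_mult less_imp_le intro!: mult_left_le)
  hence S: "(\<lambda>m. of_real (b m) * w ^ m) sums 0"
    using zero by (simp add: sums_iff)
  have "(\<lambda>m. of_real (b (Suc m)) * w ^ Suc m) sums (0 - b 0)"
    using S by (subst sums_Suc_iff) simp
  \<comment> \<open>This is the multiplication by 1 - w: w times the vanishing series, minus the
    shifted series, leaves the differences of the coefficients.\<close>
  from sums_diff[OF sums_mult[OF S, of w] this]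
  have "(\<lambda>m. of_real (?e m) * w ^ Suc m) sums of_real (b 0)"
    by (simp add: algebra_simps)
  hence 1: "(\<lambda>m. ?e m * Re (w ^ Suc m)) sums b 0"
    using sums_Re by fastforce
  have 2: "?e sums b 0"
    using telescope_sums'[OF summable_LIMSEQ_zero[OF sum]] by simp
  \<comment> \<open>The differences are nonnegative weights of total b 0, and weighting the real
    parts of w^(m+1) gives the same total. As these real parts are at most 1, each one with positive
    weight equals 1.\<close>
  have 3: "(\<lambda>m. ?e m * (1 - Re (w ^ Suc m))) sums 0"
    using sums_diff[OF 2 1] by (simp add: algebra_simps)
  have nonneg: "0 \<le> ?e m * (1 - Re (w ^ Suc m))" for m
    using dec[of m] order_trans[OF complex_Re_le_cmod le1[of "Suc m"]] by simp
  have "?e m * (1 - Re (w ^ Suc m)) = 0" for m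
    using 3 suminf_eq_zero_iff[OF sums_summable[OF 3] nonneg] by (simp add: sums_iff)
  hence Re: "Re (w ^ Suc j) = 1" "Re (w ^ Suc (Suc j)) = 1"
    using less by (force simp del: power_Suc)+
  have one: "u = 1" if "Re u = 1" "norm u \<le> 1" for u
  proof -
    have "(Re u)\<^sup>2 + (Im u)\<^sup>2 \<le> 1"
      using that(2) by (simp add: cmod_power2[symmetric] power_le_one)
    thus ?thesis using that(1) by (simp add: complex_eq_iff)
  qed
  have "w ^ Suc j = 1" "w ^ Suc (Suc j) = 1"
    using one[OF Re(1) le1] one[OF Re(2) le1] by auto
  hence "w = 1"
    by simp
  hence "suminf b = 0"
    using zero suminf_of_real[OF sum, where ?'a = complex] by simp
  thus False
    using suminf_pos[OF sum pos] by simp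
qed

section \<open>Averages over roots of unity\<close>

text \<open>Multiplication by a primitive root permutes the d-th roots of unity, so the sum is
  unchanged when multiplied by the n-th power of that root, which is not 1.\<close>

lemma sum_powers_roots_unity:
  assumes "0 < n" "n < d"
  shows "(\<Sum>z::complex | z ^ d = 1. z ^ n) = 0"
proof -
  define \<omega> where "\<omega> = cis (2 * pi * real 1 / real d)"
  have \<omega>: "\<omega> ^ d = 1"
    using bij_betw_apply[OF Complex.bij_betw_roots_unity[of d], of 1] assms
    by (auto simp: \<omega>_def )
  have "inj_on (\<lambda>k. cis (2 * pi * real k / real d)) {..<d}"
    using Complex.bij_betw_roots_unity[of d] assms by (auto simp: bij_betw_def)
  hence "cis (2 * pi * real n / real d) \<noteq> cis (2 * pi * real 0 / real d)"
    using assms by (subst inj_on_eq_iff) auto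
  hence \<omega>n: "\<omega> ^ n \<noteq> 1"
    by (simp add: \<omega>_def Complex.DeMoivre mult_ac)
  have \<omega>0: "\<omega> \<noteq> 0" by (simp add: \<omega>_def)
  have "bij_betw (\<lambda>z. \<omega> * z) {z. z ^ d = 1} {z. z ^ d = 1}"
    using \<omega> \<omega>0 by (intro bij_betwI[of _ _ _ "\<lambda>z. z / \<omega>"])
      (auto simp: power_mult_distrib power_divide)
  from sum.reindex_bij_betw[OF this, of "\<lambda>z. z ^ n"]
  have "\<omega> ^ n * (\<Sum>z | z ^ d = 1. z ^ n) = (\<Sum>z | z ^ d = 1. z ^ n)"
    by (simp add: power_mult_distrib sum_distrib_left)
  thus ?thesis
    using \<omega>n by simp
qed

text \<open>Continuity up to the boundary allows Cauchy's inequality at radius r itself, so the rate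
  is exactly 1/r. The constant does not depend on d.\<close>

lemma roots_unity_average_bound:
  assumes hol: "f holomorphic_on ball 0 r" and cont: "continuous_on (cball 0 r) f" and r: "r > 1"
  obtains C where "\<And>d. d > 0 \<Longrightarrow>
    norm (1 / of_nat d * (\<Sum>z | z ^ d = 1. f z) - f 0) \<le> C * (1 / r) ^ d"
proof -
  have "bounded (f ` cball 0 r)"
    by (intro compact_imp_bounded compact_continuous_image cont) auto
  then obtain B where B: "\<And>z. norm z \<le> r \<Longrightarrow> norm (f z) \<le> B"
    by (metis bounded_iff image_eqI mem_cball_0)
  define c where "c n = (deriv ^^ n) f 0 / fact n" for n
  have c0: "c 0 = f 0"
    by (simp add: c_def)
  have c: "norm (c n) \<le> B * (1 / r) ^ n" for n
  proof -
    have "norm ((deriv ^^ n) f 0) \<le> fact n * B / r ^ n"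
      using r by (intro Cauchy_inequality[OF hol cont] B) auto
    thus ?thesis
      by (simp add: c_def norm_divide power_one_over field_simps)
  qed
  have B0: "B \<ge> 0"
    using B[of 0] r norm_ge_zero[of "f 0"] by (simp del: norm_ge_zero)
  define avg where "avg d n = 1 / of_nat d * (\<Sum>z::complex | z ^ d = 1. z ^ n)" for d n
  have "norm (1 / of_nat d * (\<Sum>z | z ^ d = 1. f z) - f 0) \<le> B / (1 - 1 / r) * (1 / r) ^ d"
    if d: "d > 0" for d :: nat
  proof -
    have root: "norm z = 1" if "z ^ d = 1" for z :: complex
      using that d by (metis norm_one norm_power norm_ge_zero power_eq_1_iff neq0_conv)
    have "(\<lambda>n. c n * z ^ n) sums f z" if "z ^ d = 1" for z
      using holomorphic_power_series[OF hol, of z] root[OF that] r by (simp add: c_def)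
    hence "(\<lambda>n. 1 / of_nat d * (\<Sum>z | z ^ d = 1. c n * z ^ n)) sums
        (1 / of_nat d * (\<Sum>z | z ^ d = 1. f z))"
      by (intro sums_mult sums_sum) auto
    hence 1: "(\<lambda>n. c n * avg d n) sums (1 / of_nat d * (\<Sum>z | z ^ d = 1. f z))"
      by (simp add: avg_def sum_distrib_left mult_ac)
    have avg: "avg d 0 = 1" "\<And>n. 0 < n \<Longrightarrow> n < d \<Longrightarrow> avg d n = 0"
      using d by (auto simp: avg_def sum_powers_roots_unity card_roots_unity_eq)
    \<comment> \<open>From index d on this crude bound suffices: the whole geometric tail already
      has order (1/r)^d.\<close>
    have avg_le: "norm (avg d n) \<le> 1" for n
    proof -
      have "norm (\<Sum>z::complex | z ^ d = 1. z ^ n) \<le> (\<Sum>z::complex | z ^ d = 1. 1)"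
        by (intro sum_norm_le) (auto simp: norm_power root)
      thus ?thesis
        using d by (simp add: avg_def norm_mult norm_divide card_roots_unity_eq)
    qed
    \<comment> \<open>Below index d only the constant term survives, so dropping the first d terms
      subtracts exactly f 0.\<close>
    have "(\<Sum>n<d. c n * avg d n) = (\<Sum>n\<in>{0}. c n * avg d n)"
      using d avg by (intro sum.mono_neutral_right) auto
    hence "(\<lambda>n. c (n + d) * avg d (n + d)) sums
        (1 / of_nat d * (\<Sum>z | z ^ d = 1. f z) - f 0)"
      using 1 avg(1) c0 by (subst sums_iff_shift) simp
    moreover have "norm (c (n + d) * avg d (n + d)) \<le> B * (1 / r) ^ d * (1 / r) ^ n" for n
      using mult_mono[OF c avg_le, of "n + d" "n + d"] r B0
      by (simp add: norm_mult power_add mult_ac)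
    moreover have "(\<lambda>n. B * (1 / r) ^ d * (1 / r) ^ n) sums (B * (1 / r) ^ d * (1 / (1 - 1 / r)))"
      using r by (intro sums_mult geometric_sums) auto
    ultimately have "norm (1 / of_nat d * (\<Sum>z | z ^ d = 1. f z) - f 0) \<le>
        B * (1 / r) ^ d * (1 / (1 - 1 / r))"
      using norm_suminf_le by (metis (no_types, lifting) sums_iff)
    thus ?thesis by (simp add: mult_ac)
  qed
  thus ?thesis using that by blast
qed

section \<open>The series in the numerator and denominator of J\<close>

text \<open>The offset b covers both series at once: b = 1 gives the numerator and b = a the
  denominator.\<close>

definition Phi_series :: "nat \<Rightarrow> nat \<Rightarrow> nat \<Rightarrow> complex \<Rightarrow> complex \<Rightarrow> complex" where
  "Phi_series a b k z q = (\<Sum>m. z ^ m * q ^ (a * m + b) * Phi (q ^ (a * m + b)) ^ k)"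

lemma J_num_conv_Phi_series: "J_num a k z q = Phi_series a 1 k z q"
  by (simp add: J_num_def Phi_series_def)

lemma J_den_conv_Phi_series: "J_den a k z q = Phi_series a a k z q"
  by (simp add: J_den_def Phi_series_def add.commute)

lemma Phi_series_0: "Phi_series a b k 0 q = q ^ b * Phi (q ^ b) ^ k"
proof -
  have "(\<lambda>m. 0 ^ m * q ^ (a * m + b) * Phi (q ^ (a * m + b)) ^ k) sums
      (\<Sum>m\<in>{0}. 0 ^ m * q ^ (a * m + b) * Phi (q ^ (a * m + b)) ^ k)"
    by (intro sums_finite) auto
  thus ?thesis
    by (simp add: Phi_series_def sums_iff)
qed

text \<open>The powers \<open>q ^ (a * m + b)\<close> stay in a compact subdisk, on which \<open>Phi\<close> is bounded; so the
  series is dominated by a geometric series with ratio \<open>norm z * norm q ^ a\<close>.\<close>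

lemma Phi_series_uniform_bound:
  assumes "b > 0" "\<rho> < 1"
  obtains C where "\<And>z q m. norm q \<le> \<rho> \<Longrightarrow> norm z * norm q ^ a \<le> t \<Longrightarrow>
    norm (z ^ m * q ^ (a * m + b) * Phi (q ^ (a * m + b)) ^ k) \<le> C * t ^ m"
proof -
  have "bounded (Phi ` cball 0 \<rho>)"
    using assms by (intro compact_imp_bounded compact_continuous_image continuous_on_subset[OF
      holomorphic_on_imp_continuous_on[OF Phi_holomorphic]]) auto
  then obtain B where B: "\<And>q. norm q \<le> \<rho> \<Longrightarrow> norm (Phi q) \<le> B"
    by (metis bounded_iff image_eqI mem_cball_0)
  have "norm (z ^ m * q ^ (a * m + b) * Phi (q ^ (a * m + b)) ^ k) \<le> B ^ k * t ^ m"
    if q: "norm q \<le> \<rho>" and z: "norm z * norm q ^ a \<le> t" for z q m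
  proof -
    have q1: "norm q \<le> 1" using q assms by simp
    \<comment> \<open>Because b > 0 the exponent is at least 1, which keeps the argument of
      \<open>Phi\<close> in the disk of radius \<open>\<rho>\<close>.\<close>
    have "norm q ^ (a * m + b) \<le> norm q ^ 1"
      using assms q1 by (intro power_decreasing) auto
    hence *: "norm (Phi (q ^ (a * m + b))) \<le> B"
      using q by (intro B) (simp add: norm_power)
    have "norm (z ^ m * q ^ (a * m + b)) = (norm z * norm q ^ a) ^ m * norm q ^ b"
      by (simp add: norm_mult norm_power power_add power_mult power_mult_distrib)
    also have "\<dots> \<le> t ^ m * 1"
      using z q1 order_trans[OF _ z, of 0] by (intro mult_mono power_mono power_le_one) auto
    finally show ?thesis
      using * order_trans[OF _ z, of 0] 
      by (subst norm_mult, subst norm_power, subst mult.commute) (intro mult_mono power_mono; simp)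
  qed
  thus ?thesis using that by blast
qed

text \<open>Both arguments are functions of w because two cases are needed: z varies with q fixed
  for Taylor expansion, and q varies with z fixed for analyticity of the sections.\<close>

lemma Phi_series_holomorphic:
  assumes S: "open S" and hol: "f holomorphic_on S" "g holomorphic_on S" and b: "b > 0"
    and g: "\<And>w. w \<in> S \<Longrightarrow> norm (g w) < 1" and fg: "\<And>w. w \<in> S \<Longrightarrow> norm (f w) * norm (g w) ^ a < 1"
  shows "(\<lambda>w. Phi_series a b k (f w) (g w)) holomorphic_on S"
proof (rule holomorphic_uniform_sequence[OF S])
  show "(\<lambda>w. \<Sum>m<N. f w ^ m * g w ^ (a * m + b) * Phi (g w ^ (a * m + b)) ^ k) holomorphic_on S" for N
  proof (intro holomorphic_intros hol)
    fix m
    show "(\<lambda>w. Phi (g w ^ (a * m + b))) holomorphic_on S"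
      using b g by (intro holomorphic_on_compose_gen[OF _ Phi_holomorphic, unfolded o_def]
         holomorphic_intros hol) (auto simp: norm_power power_less_one_iff)
  qed
  fix x assume x: "x \<in> S"
  then obtain d where d: "d > 0" "cball x d \<subseteq> S"
    using S by (meson open_contains_cball)
  have cont: "continuous_on (cball x d) f" "continuous_on (cball x d) g"
    using hol d(2) by (auto intro: continuous_on_subset holomorphic_on_imp_continuous_on)
  \<comment> \<open>Maxima attained on the closed disk turn the two pointwise strict bounds into
    uniform ones, as the M-test requires.\<close>
  obtain u where u: "u \<in> cball x d" "\<And>w. w \<in> cball x d \<Longrightarrow> norm (g w) \<le> norm (g u)"
    using continuous_attains_sup[of "cball x d" "\<lambda>w. norm (g w)"] d(1) cont
    by (fastforce intro: continuous_intros)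
  obtain v where v: "v \<in> cball x d"
    "\<And>w. w \<in> cball x d \<Longrightarrow> norm (f w) * norm (g w) ^ a \<le> norm (f v) * norm (g v) ^ a"
    using continuous_attains_sup[of "cball x d" "\<lambda>w. norm (f w) * norm (g w) ^ a"] d(1) cont
    by (fastforce intro: continuous_intros)
  define t where "t = norm (f v) * norm (g v) ^ a"
  obtain C where C: "\<And>z q m. norm q \<le> norm (g u) \<Longrightarrow> norm z * norm q ^ a \<le> t \<Longrightarrow>
      norm (z ^ m * q ^ (a * m + b) * Phi (q ^ (a * m + b)) ^ k) \<le> C * t ^ m"
    using Phi_series_uniform_bound[OF b g] u d(2) by blast
  have "uniform_limit (cball x d)
     (\<lambda>N w. \<Sum>m<N. f w ^ m * g w ^ (a * m + b) * Phi (g w ^ (a * m + b)) ^ k)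
     (\<lambda>w. Phi_series a b k (f w) (g w)) sequentially"
    unfolding Phi_series_def
  proof (rule Weierstrass_m_test)
    show "summable (\<lambda>m. C * t ^ m)"
      using fg[of v] v(1) d(2) by (intro summable_mult summable_geometric) (auto simp: t_def)
  qed (use C u v in \<open>auto simp: t_def\<close>)
  thus "\<exists>d>0. cball x d \<subseteq> S \<and> uniform_limit (cball x d)
     (\<lambda>N w. \<Sum>m<N. f w ^ m * g w ^ (a * m + b) * Phi (g w ^ (a * m + b)) ^ k)
     (\<lambda>w. Phi_series a b k (f w) (g w)) sequentially"
    using d by blast
qed

section \<open>Nonvanishing of the denominator\<close>

lemma phi_le_one:
  assumes "0 < x" "x < 1"
  shows "phi x \<le> 1"
proof (rule has_prod_le[OF has_prod_phi has_prod_one])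
  show "0 \<le> 1 - x ^ Suc n \<and> 1 - x ^ Suc n \<le> 1" for n
    using assms power_le_one[of x "Suc n"] by auto
qed (use assms in auto)

lemma J_den_nonzero:
  fixes q :: real
  assumes a: "a \<ge> 1" and k: "k \<ge> 1" and q: "0 < q" "q < 1"
    and z: "norm z \<le> inverse (beta k (q ^ a))"
  shows "J_den a k z (of_real q) \<noteq> 0"
proof -
  define Q where "Q = q ^ a"
  have Q: "0 < Q" "Q < 1"
    using a q by (auto simp: Q_def power_less_one_iff)
  define B where "B = beta k Q"
  have BQ: "Q < B"
    unfolding B_def using Q k by (rule beta_gt_self)
  have B: "B > 0" using BQ Q by simp
  have Qpow: "0 < Q ^ Suc m" "Q ^ Suc m < 1" for m
    using Q power_Suc_less_one[of Q m] by auto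
  have phi: "0 < phi (Q ^ Suc m)" "phi (Q ^ Suc m) \<le> 1" for m
    using Qpow[of m] by (auto intro!: phi_pos phi_le_one simp: abs_of_pos simp del: power_Suc)
  have phi': "0 < phi Q" using phi[of 0] by simp
  define c where "c m = Q ^ Suc m * phi (Q ^ Suc m) ^ k" for m
  have c: "c m > 0" for m
    unfolding c_def using Q phi(1)[of m] by (intro mult_pos_pos zero_less_power)
  have ratio: "phi (Q ^ Suc (Suc m)) \<le> phi (Q\<^sup>2) / phi Q * phi (Q ^ Suc m)" for m
    using phi_ratio_le[OF Q, of m] phi' by (simp add: field_simps del: power_Suc)
  have ratio': "phi (Q ^ Suc (Suc m)) < phi (Q\<^sup>2) / phi Q * phi (Q ^ Suc m)" if "m > 0" for m
    using phi_ratio_less[OF Q that] phi' by (simp add: field_simps del: power_Suc)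
  \<comment> \<open>In this form \<open>B * c m\<close> and \<open>c (Suc m)\<close> share their
    power of Q, and only the bases of two k-th powers remain to be compared.\<close>
  have Bc: "B * c m = Q ^ Suc (Suc m) * (phi (Q\<^sup>2) / phi Q * phi (Q ^ Suc m)) ^ k" for m
    by (simp only: B_def beta_eq[OF Q] c_def power_Suc power_mult_distrib mult_ac)
  have c_le: "c (Suc m) \<le> B * c m" for m
    unfolding Bc unfolding c_def using Qpow[of "Suc m"] phi[of "Suc m"] ratio[of m]
    by (intro mult_left_mono power_mono) auto
  have c_less: "c (Suc m) < B * c m" if "m > 0" for m
    unfolding Bc unfolding c_def using Qpow[of "Suc m"] phi[of "Suc m"] ratio'[OF that] k
    by (intro mult_strict_left_mono power_strict_mono) auto
  \<comment> \<open>The substitution w = B z maps the disk of radius 1/B onto the closed unit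
    disk.\<close>
  define b where "b m = c m / B ^ m" for m
  have "(\<Sum>m. of_real (b m) * (B * z) ^ m) \<noteq> 0"
  proof (rule decreasing_coeffs_nonzero)
    show "b m > 0" for m using c B by (simp add: b_def)
    show "b (Suc m) \<le> b m" for m
      using c_le[of m] B by (simp add: b_def field_simps)
    \<comment> \<open>Strict decrease starts only at index 1, since \<open>c 1 = B * c 0\<close>
      makes b 1 equal to b 0.\<close>
    show "b (Suc (Suc 1)) < b (Suc 1)" "b (Suc 1) < b 1"
      using c_less[of 1] c_less[of 2] B by (simp_all add: b_def field_simps eval_nat_numeral)
    show "summable b"
    proof (rule summable_comparison_test'[of _ 0])
      show "summable (\<lambda>m. Q * (Q / B) ^ m)"
        using Q BQ B by (intro summable_mult summable_geometric) auto
      fix m :: nat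
      have "c m \<le> Q ^ Suc m * 1"
        unfolding c_def using Qpow[of m] phi[of m] by (intro mult_left_mono power_le_one) auto
      thus "norm (b m) \<le> Q * (Q / B) ^ m"
        using B c[of m] by (simp add: b_def power_divide divide_right_mono)
    qed
    show "norm (B * z) \<le> 1"
      using z B by (simp add: norm_mult B_def Q_def field_simps)
  qed
  moreover have "of_real (b m) * (B * z) ^ m =
      z ^ m * of_real q ^ (a * (m + 1)) * Phi (of_real q ^ (a * (m + 1))) ^ k" for m
  proof -
    have "of_real q ^ (a * (m + 1)) = (of_real (Q ^ Suc m) :: complex)"
      by (simp only: Q_def power_mult Suc_eq_plus1 of_real_power)
    moreover have "Phi (of_real (Q ^ Suc m)) = of_real (phi (Q ^ Suc m))"
      using Qpow[of m] by (intro Phi_of_real) auto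
    ultimately show ?thesis
      using B by (simp add: b_def c_def power_mult_distrib del: power_Suc)
  qed
  ultimately show ?thesis
    by (simp add: J_den_def)
qed

section \<open>Holomorphy of J and convergence of the sections\<close>

text \<open>Provides room beyond the closed disk. At \<open>beta k Q = 1\<close> that disk is the
  unit disk, and exponential decay needs a radius above 1.\<close>

lemma cball_subset_open_extend:
  fixes V :: "'a::euclidean_space set"
  assumes "open V" "cball 0 R \<subseteq> V" "R > 0"
  obtains r where "r > R" "cball 0 r \<subseteq> V"
proof -
  obtain e where e: "e > 0" "(\<Union>x\<in>cball 0 R. ball x e) \<subseteq> V"
    using compact_subset_open_imp_ball_epsilon_subset[OF compact_cball assms(1,2)] by blast
  have "x \<in> V" if x: "norm x \<le> R + e / 2" for x
  proof (cases "norm x \<le> R")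
    case True
    thus ?thesis using assms(2) by auto
  next
    case False
    hence "x \<noteq> 0" using assms(3) by auto
    \<comment> \<open>The radial projection of x to the sphere of radius R lies within e/2 of
      x.\<close>
    define y where "y = (R / norm x) *\<^sub>R x"
    have "x - y = (1 - R / norm x) *\<^sub>R x"
      by (simp add: y_def scaleR_diff_left)
    moreover have "R / norm x \<le> 1"
      using False assms(3) by (subst divide_le_eq_1_pos) auto
    ultimately have "norm (x - y) = (1 - R / norm x) * norm x"
      by simp
    hence "norm (x - y) = norm x - R"
      using \<open>x \<noteq> 0\<close> by (simp add: left_diff_distrib)
    hence "dist y x < e"
      using x e(1) by (simp add: dist_norm norm_minus_commute)
    moreover have "norm y \<le> R"
      using False assms(3) by (simp add: y_def)
    ultimately show ?thesis
      using e(2) by force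
  qed
  hence "cball 0 (R + e / 2) \<subseteq> V" by auto
  with e(1) show ?thesis by (intro that[of "R + e / 2"]) auto
qed

lemma J_quot_0:
  assumes "q \<noteq> 0"
  shows "J_quot a k 0 q = T_lim a k q"
  using assms
  by (simp add: J_quot_def J_num_conv_Phi_series J_den_conv_Phi_series Phi_series_0 T_lim_def
    power_int_diff)

lemma J_quot_holomorphic:
  fixes q :: real
  assumes a: "a \<ge> 1" and k: "k \<ge> 1" and q: "0 < q" "q < 1"
  obtains V where "open V" "cball 0 (inverse (beta k (q ^ a))) \<subseteq> V"
    "(\<lambda>z. J_quot a k z (of_real q)) holomorphic_on V"
proof -
  define Q where "Q = q ^ a"
  have Q: "0 < Q" "Q < 1"
    using a q by (auto simp: Q_def power_less_one_iff)
  define U where "U = ball (0::complex) (inverse Q)"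
  have small: "norm z * norm (complex_of_real q) ^ a < 1" if "z \<in> U" for z
    using that q Q by (simp add: U_def field_simps flip: Q_def)
  have num: "(\<lambda>z. J_num a k z (of_real q)) holomorphic_on U"
    unfolding J_num_conv_Phi_series using small q
    by (intro Phi_series_holomorphic) (auto simp: U_def)
  have den: "(\<lambda>z. J_den a k z (of_real q)) holomorphic_on U"
    unfolding J_den_conv_Phi_series using small q a
    by (intro Phi_series_holomorphic) (auto simp: U_def)
  \<comment> \<open>U is the disk of convergence, of radius 1/Q. It contains the closed zero-free
    disk because Q < \<open>beta k Q\<close>.\<close>
  define V where "V = {z \<in> U. J_den a k z (of_real q) \<noteq> 0}"
  show ?thesis
  proof
    have "open (U \<inter> (\<lambda>z. J_den a k z (of_real q)) -` (- {0}))"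
      using den by (intro continuous_open_preimage holomorphic_on_imp_continuous_on)
        (auto simp: U_def)
    also have "\<dots> = V"
      by (auto simp: V_def)
    finally show "open V" .
    have "inverse (beta k Q) < inverse Q"
      using Q beta_gt_self[OF Q k] by (simp add: less_imp_inverse_less)
    thus "cball 0 (inverse (beta k (q ^ a))) \<subseteq> V"
      using J_den_nonzero[OF a k q] by (auto simp: V_def U_def simp flip: Q_def)
    show "(\<lambda>z. J_quot a k z (of_real q)) holomorphic_on V"
      unfolding J_quot_def using num den
      by (intro holomorphic_intros holomorphic_on_subset[OF num] holomorphic_on_subset[OF den])
        (auto simp: V_def)
  qed
qed

lemma W_section_error_bigo:
  fixes q r :: real
  assumes "V \<supseteq> cball 0 r" "(\<lambda>z. J_quot a k z (of_real q)) holomorphic_on V" "r > 1" "q \<noteq> 0"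
  shows "(\<lambda>d. norm (W_section a d (of_real q) k - T_lim a k (of_real q))) \<in> O(\<lambda>d. (1 / r) ^ d)"
proof -
  let ?J = "\<lambda>z. J_quot a k z (of_real q)"
  have "?J holomorphic_on ball 0 r" "continuous_on (cball 0 r) ?J"
    using assms(1,2) ball_subset_cball[of 0 r]
    by (blast intro: holomorphic_on_subset holomorphic_on_imp_continuous_on)+
  then obtain C where C: "\<And>d. d > 0 \<Longrightarrow>
      norm (1 / of_nat d * (\<Sum>z | z ^ d = 1. ?J z) - ?J 0) \<le> C * (1 / r) ^ d"
    using roots_unity_average_bound[OF _ _ assms(3)] by blast
  show ?thesis
  proof (rule bigoI)
    show "\<forall>\<^sub>F d in sequentially. norm (norm (W_section a d (of_real q) k - T_lim a k (of_real q)))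
        \<le> C * norm ((1 / r) ^ d)"
      using eventually_gt_at_top[of 0]
    proof eventually_elim
      case (elim d)
      thus ?case
        using C[OF elim] assms(3,4) by (simp add: W_section_def J_quot_0)
    qed
  qed
qed

text \<open>For |z| = 1 both series converge for all |p| < 1. The bound on \<open>beta\<close> puts
  z in the zero-free disk at the real point q, and nonvanishing at that single point makes the
  quotient analytic there.\<close>

lemma W_section_analytic:
  fixes q :: real
  assumes a: "a \<ge> 1" and k: "k \<ge> 1" and q: "0 < q" "q < 1" and beta: "beta k (q ^ a) \<le> 1"
    and d: "d > 0"
  shows "(\<lambda>p. W_section a d p k) analytic_on {of_real q}"
proof -
  have "(\<lambda>p. J_quot a k z p) analytic_on {of_real q}" if "z ^ d = 1" for z
  proof -
    have z: "norm z = 1"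
      using that d by (metis norm_one norm_power norm_ge_zero power_eq_1_iff neq0_conv)
    have hol: "(\<lambda>p. Phi_series a b k z p) holomorphic_on ball 0 1" if "b > 0" for b
    proof (rule Phi_series_holomorphic[OF _ _ _ that])
      show "norm z * norm p ^ a < 1" if "p \<in> ball 0 1" for p :: complex
        using that a by (simp add: z power_less_one_iff)
    qed simp_all
    have an: "(\<lambda>p. Phi_series a b k z p) analytic_on {of_real q}" if "b > 0" for b
    proof (rule analytic_on_subset)
      show "(\<lambda>p. Phi_series a b k z p) analytic_on ball 0 1"
        using hol[OF that] by (simp add: analytic_on_open)
    qed (use q in simp)
    have "beta k (q ^ a) > 0"
      using a q by (intro beta_pos) (auto simp: power_less_one_iff)
    hence "J_den a k z (of_real q) \<noteq> 0"
      using z beta by (intro J_den_nonzero a k q) (simp add: one_le_inverse_iff)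
    thus ?thesis
      unfolding J_quot_def J_num_conv_Phi_series J_den_conv_Phi_series
      using a by (intro analytic_on_divide an) auto
  qed
  thus ?thesis
    unfolding W_section_def by (intro analytic_intros) auto
qed

theorem theorem3p3:
  fixes a k :: nat and q :: real
  assumes "a \<ge> 2" and "k \<ge> 1" and "0 < q" and "q < 1"
  shows "(\<forall>z::complex. norm z \<le> inverse (beta k (q ^ a)) \<longrightarrow> J_den a k z (of_real q) \<noteq> 0) \<and>
    (q \<le> root a (Q_star k) \<longrightarrow>
      (\<forall>d\<ge>2. (\<lambda>p. W_section a d p k) analytic_on {of_real q} \<and>
              \<not> is_pole (\<lambda>p. W_section a d p k) (of_real q)) \<and>
      (\<lambda>d. W_section a d (of_real q) k) \<longlonglongrightarrow> T_lim a k (of_real q) \<and>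
      (\<exists>\<rho>::real. 0 < \<rho> \<and> \<rho> < 1 \<and>
        (\<lambda>d. norm (W_section a d (of_real q) k - T_lim a k (of_real q))) \<in> O(\<lambda>d. \<rho> ^ d))) \<and>
    (q ^ a < Q_star k \<longrightarrow>
      (\<lambda>d. norm (W_section a d (of_real q) k - T_lim a k (of_real q))) \<in> O(\<lambda>d. beta k (q ^ a) ^ d))"
proof -
  let ?err = "\<lambda>d. norm (W_section a d (of_real q) k - T_lim a k (of_real q))"
  have a: "a \<ge> 1" using assms(1) by simp
  define Q where "Q = q ^ a"
  have Q: "0 < Q" "Q < 1"
    using a assms(3,4) by (auto simp: Q_def power_less_one_iff)
  note Qs = Q_star[OF assms(2)]
  have B: "beta k Q > 0"
    using Q by (rule beta_pos)
  obtain V where V: "open V" "cball 0 (inverse (beta k Q)) \<subseteq> V"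
    "(\<lambda>z. J_quot a k z (of_real q)) holomorphic_on V"
    using J_quot_holomorphic[OF a assms(2-4)] unfolding Q_def by blast
  have "J_den a k z (of_real q) \<noteq> 0" if "norm z \<le> inverse (beta k Q)" for z
    using J_den_nonzero[OF a assms(2-4)] that by (simp add: Q_def)
  moreover have "(\<forall>d\<ge>2. (\<lambda>p. W_section a d p k) analytic_on {of_real q} \<and>
              \<not> is_pole (\<lambda>p. W_section a d p k) (of_real q)) \<and>
      (\<lambda>d. W_section a d (of_real q) k) \<longlonglongrightarrow> T_lim a k (of_real q) \<and>
      (\<exists>\<rho>::real. 0 < \<rho> \<and> \<rho> < 1 \<and> ?err \<in> O(\<lambda>d. \<rho> ^ d))" if "q \<le> root a (Q_star k)"
  proof (intro conjI allI impI)
    have "Q \<le> root a (Q_star k) ^ a"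
      unfolding Q_def using that assms(3) by (intro power_mono) auto
    also have "\<dots> = Q_star k"
      using a Qs by (intro real_root_pow_pos2) auto
    finally have le1: "beta k Q \<le> 1"
      using beta_less[of Q "Q_star k" k] Q Qs by (cases "Q = Q_star k") auto
    show an: "(\<lambda>p. W_section a d p k) analytic_on {of_real q}" if "d \<ge> 2" for d
      using W_section_analytic[OF a assms(2-4)] le1 that by (simp add: Q_def)
    show "\<not> is_pole (\<lambda>p. W_section a d p k) (of_real q)" if "d \<ge> 2" for d
      using an[OF that] by (rule analytic_at_imp_no_pole)
    \<comment> \<open>The enlarged radius also handles the boundary case
      \<open>beta k Q = 1\<close>, at the price of an unspecified rate.\<close>
    obtain r where r: "r > inverse (beta k Q)" "cball 0 r \<subseteq> V"
      using cball_subset_open_extend[OF V(1,2)] B by auto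
    have "inverse (beta k Q) \<ge> 1"
      using B le1 by (simp add: one_le_inverse_iff)
    hence r1: "r > 1" using r(1) by simp
    have err: "?err \<in> O(\<lambda>d. (1 / r) ^ d)"
      using r(2) V(3) r1 assms(3) by (intro W_section_error_bigo) auto
    thus "\<exists>\<rho>::real. 0 < \<rho> \<and> \<rho> < 1 \<and> ?err \<in> O(\<lambda>d. \<rho> ^ d)"
      using r1 by (intro exI[of _ "1 / r"]) auto
    have "(\<lambda>d. (1 / r) ^ d) \<longlonglongrightarrow> 0"
      using r1 by (intro LIMSEQ_realpow_zero) auto
    hence "(\<lambda>d. (1 / r) ^ d) \<in> o(\<lambda>_. 1)"
      by (intro smalloI_tendsto) auto
    with err have "?err \<in> o(\<lambda>_. 1)"
      by (rule landau_o.big_small_trans)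
    hence "?err \<longlonglongrightarrow> 0"
      using smalloD_tendsto by fastforce
    thus "(\<lambda>d. W_section a d (of_real q) k) \<longlonglongrightarrow> T_lim a k (of_real q)"
      by (simp add: tendsto_norm_zero_iff LIM_zero_iff)
  qed
  moreover have "?err \<in> O(\<lambda>d. beta k Q ^ d)" if "Q < Q_star k"
  proof -
    have "beta k Q < 1"
      using beta_less[of Q "Q_star k" k] Q Qs that by simp
    \<comment> \<open>Here the radius 1 / \<open>beta k Q\<close> already exceeds 1, so it is used
      without enlargement and gives the stated rate.\<close>
    hence "?err \<in> O(\<lambda>d. (1 / inverse (beta k Q)) ^ d)"
      using V(2,3) B assms(3) by (intro W_section_error_bigo) (auto simp: one_less_inverse_iff)
    moreover have "1 / inverse (beta k Q) = beta k Q"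
      by (simp add: inverse_eq_divide)
    ultimately show ?thesis by metis
  qed
  ultimately show ?thesis
    unfolding Q_def by blast
qed

end
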